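(* Let $k\ge2$ be an integer, let $1<p<\infty$ and $1\le q<\infty$. Let $0<\alpha_k<\cdots<\alpha_1<1$ be such that, for each $m=1,\ldots,k$, $\alpha_m=\frac{\log t_{0,m}}{\log N_0}$ for some $t_{0,m},N_0\in\mathbb{N}$ (with $N_0$ the same for all $m$), and $(k-1)\alpha_1+\alpha_k<2$. Then there exist $k$ non-zero, finite Borel measures $\mu_1,\ldots,\mu_k$ on $\mathbb{R}$, with $\mu_m$ supported on a compact set $E_m\subseteq\mathbb{R}$, satisfying for each $m=1,\ldots,k$ $$|\widehat{d\mu_m}(\xi)|\lesssim|\xi|^{-\beta_m/2}\quad (\xi\in\mathbb{R}\setminus\{0\})$$ for every $\beta_m<\alpha_m$, and $$\mu_m(B(x,r))\lesssim r^{\alpha_m}\quad\text{for all }x\in E_m\text{ and }r>0,$$ such that the following holds: if $$q<\frac{p\big(2-\sum_{m=1}^k\alpha_m\big)}{(p-1)\sum_{m=1}^k\alpha_m},$$ then there exist $k$ sequences of functions $\{f_{\ell,m}\}_{\ell\in\mathbb{N}}$, $m=1,\ldots,k$, such that $$\frac{\big\|\prod_{m=1}^k\widehat{f_{\ell,m}\,d\mu_m}\big\|_{L^q(\mathbb{R})}}{\prod_{m=1}^k\|f_{\ell,m}\|_{L^p(d\mu_m)}}\to\infty\quad\text{as }\ell\to\infty.$$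
   Context: For a finite Borel measure $\mu$ on $\mathbb{R}$ and $f\in L^1(\mu)$, $\widehat{f\,d\mu}(\xi)=\int f(x)e^{-2\pi i x\xi}\,d\mu(x)$, and $\widehat{d\mu}$ is the case $f\equiv1$. $B(x,r)$ is the ball of centre $x$ and radius $r$. $A\lesssim B$ means $A\le CB$ for some constant $0<C<\infty$; in the Fourier decay condition the constant is independent of $\xi$ (it may depend on $\beta_m$), and in the ball condition it is independent of $x$ and $r$. In the quotient, $f_{\ell,m}\in L^p(d\mu_m)$ has $0<\|f_{\ell,m}\|_{L^p(d\mu_m)}<\infty$.
   Formalization: The Fourier decay bound is required only for 0 ≤ β_m < α_m; for β_m < 0 it fails for every non-zero finite measure, since as ξ → 0 the left side tends to μ_m(ℝ) > 0 and the right side to 0. *)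

theory Defs
  imports "HOL-Probability.Probability"
begin

definition fourier_measure :: "real measure \<Rightarrow> (real \<Rightarrow> complex) \<Rightarrow> real \<Rightarrow> complex" where
  "fourier_measure M f \<xi> = (LINT x|M. f x * exp (- (2 * pi * \<i> * x * \<xi>)))"

text \<open>
  The value is \<open>\<infinity>\<close> exactly when \<open>|f|\<^sup>p\<close> has infinite integral, and membership in \<open>L\<^sup>p\<close>
  is measurability together with a finite norm.  Elements of \<open>L\<^sup>p\<close> are represented by functions,
  not by classes modulo null sets.
\<close>

definition Lp_norm :: "real \<Rightarrow> 'a measure \<Rightarrow> ('a \<Rightarrow> complex) \<Rightarrow> ennreal" where
  "Lp_norm p M f =
     (let I = (\<integral>\<^sup>+ x. ennreal (norm (f x) powr p) \<partial>M)
      in if I = \<infinity> then \<infinity> else ennreal (enn2real I powr (1 / p)))"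

definition Lp_space :: "real \<Rightarrow> 'a measure \<Rightarrow> ('a \<Rightarrow> complex) set" where
  "Lp_space p M = {f \<in> borel_measurable M. Lp_norm p M f < \<infinity>}"

definition supported_on :: "real measure \<Rightarrow> real set \<Rightarrow> bool" where
  "supported_on M E \<longleftrightarrow> emeasure M (- E) = 0"

text \<open>
  The exponent \<open>\<beta>\<close> ranges over \<open>0 \<le> \<beta> < \<alpha>\<close>: for \<open>\<beta> < 0\<close> the right-hand side tends to 0 as
  \<open>\<xi> \<rightarrow> 0\<close>, whereas the transform tends to the total mass, so the bound would fail for every
  non-zero measure.
\<close>

definition fourier_decay :: "real measure \<Rightarrow> real \<Rightarrow> bool" where
  "fourier_decay M \<alpha> \<longleftrightarrow>
     (\<forall>\<beta>. 0 \<le> \<beta> \<and> \<beta> < \<alpha> \<longrightarrow>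
        (\<exists>C>0. \<forall>\<xi>. \<xi> \<noteq> 0 \<longrightarrow> norm (fourier_measure M (\<lambda>_. 1) \<xi>) \<le> C * \<bar>\<xi>\<bar> powr (- \<beta> / 2)))"

definition ball_condition :: "real measure \<Rightarrow> real set \<Rightarrow> real \<Rightarrow> bool" where
  "ball_condition M E \<alpha> \<longleftrightarrow> (\<exists>C>0. \<forall>x\<in>E. \<forall>r>0. measure M (ball x r) \<le> C * r powr \<alpha>)"

end

theory Submission
  imports Defs "HOL-Real_Asymp.Real_Asymp"
begin

text \<open>
  No random construction is needed, because the Fourier and ball conditions are only upper bounds.
  Fix \<open>a\<close> slightly above \<open>\<alpha>\<close>. At scale \<open>2\<^sup>-\<^sup>l\<close> take about \<open>2 powr (a l / 2)\<close> equally spaced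
  intervals of length \<open>2\<^sup>-\<^sup>l\<close>, each of mass \<open>2 powr (- a l)\<close>. The total mass \<open>2 powr (- a l / 2)\<close> of
  this comb is already so small that it has Fourier decay of order \<open>a / 2\<close>, and it satisfies the
  ball condition with exponent \<open>a\<close>; the margin \<open>a - \<alpha>\<close> makes the sum over all \<open>l\<close> converge.

  The transform of the comb is comparable to its mass within distance \<open>1/16\<close> of every multiple of
  the number of intervals, up to frequency about \<open>2\<^sup>l\<close>. These numbers are powers of two, so the
  large frequencies of the comb of the largest exponent \<open>b\<close> are shared by all factors. Hence the
  product is large on a set of measure about \<open>2 powr ((1 - b / 2) l)\<close>, and the quotient diverges
  for \<open>q < p (2 - b) / ((p - 1) (\<Sum> a))\<close>, a larger range than the one required.
\<close>

section \<open>Interpolation between two bounds, and counting integers in an interval\<close>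

text \<open>Split \<open>z\<close> into \<open>z powr (1 - s) * z powr s\<close> and bound the
  factors separately. This turns two extreme bounds on a comb, one by mass and one by height or
  oscillation, into bounds with an intermediate exponent.\<close>

lemma interpolate_le_powr:
  fixes z X Y s :: real
  assumes "0 \<le> z" "z \<le> X" "z \<le> Y" "0 \<le> s" "s \<le> 1"
  shows "z \<le> X powr (1 - s) * Y powr s"
proof (cases "z = 0")
  case False
  then have "z = z powr (1 - s) * z powr s"
    using assms(1) by (simp flip: powr_add)
  also have "\<dots> \<le> X powr (1 - s) * Y powr s"
    using assms by (intro mult_mono powr_mono2) auto
  finally show ?thesis .
qed simp

lemma card_nat_between_le:
  fixes u v :: real
  assumes "u \<le> v"
  shows "real (card {j::nat. u < real j \<and> real j < v}) \<le> v - u + 1"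
proof -
  have "card {j::nat. u < real j \<and> real j < v} = card (int ` {j::nat. u < real j \<and> real j < v})"
    by (simp add: card_image)
  also have "\<dots> \<le> card {\<lfloor>u\<rfloor> + 1..\<lceil>v\<rceil> - 1}"
    by (intro card_mono) (auto, linarith+)
  also have "real \<dots> \<le> v - u + 1"
    using assms by simp linarith
  finally show ?thesis by simp
qed

section \<open>A single comb: its Fourier transform and its mass in balls\<close>

text \<open>The teeth are half-open, so they stay disjoint in the extreme case \<open>t = l\<close>,
  where they tile the unit interval.\<close>

definition comb :: "nat \<Rightarrow> nat \<Rightarrow> real \<Rightarrow> real" where
  "comb t l x = (\<Sum>j<2 ^ t. indicator {real j / 2 ^ t..<real j / 2 ^ t + 1 / 2 ^ l} x)"

lemma comb_measurable [measurable]: "comb t l \<in> borel_measurable borel"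
  unfolding comb_def by measurable

lemma comb_nonneg: "0 \<le> comb t l x"
  unfolding comb_def by (intro sum_nonneg) auto

lemma comb_nonzeroE:
  assumes "comb t l x \<noteq> 0"
  obtains j where "j < 2 ^ t" "real j / 2 ^ t \<le> x" "x < real j / 2 ^ t + 1 / 2 ^ l"
proof -
  obtain j where "j < 2 ^ t" "indicator {real j / 2 ^ t..<real j / 2 ^ t + 1 / 2 ^ l} x \<noteq> (0::real)"
    using assms unfolding comb_def by (meson lessThan_iff sum.not_neutral_contains_not_neutral)
  then show ?thesis
    by (intro that[of j]) (auto simp: indicator_def split: if_splits)
qed

text \<open>A tooth is no longer than the spacing \<open>1 / 2 ^ t\<close>, so the only tooth that
  can contain \<open>x\<close> has index \<open>\<lfloor>x * 2 ^ t\<rfloor>\<close>.\<close>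

lemma comb_le_1:
  assumes "t \<le> l"
  shows "comb t l x \<le> 1"
proof -
  let ?J = "{j::nat. j < 2 ^ t \<and> x \<in> {real j / 2 ^ t..<real j / 2 ^ t + 1 / 2 ^ l}}"
  have le: "1 / 2 ^ l \<le> (1 / 2 ^ t :: real)"
    using assms by (intro divide_left_mono) auto
  have floor: "int j = \<lfloor>x * 2 ^ t\<rfloor>" if "j \<in> ?J" for j
  proof (rule floor_unique[symmetric])
    have "x < real j / 2 ^ t + 1 / 2 ^ t" using that le by auto
    then show "x * 2 ^ t < of_int (int j) + 1" by (simp add: field_simps)
  qed (use that in \<open>simp add: divide_le_eq\<close>)
  then have "?J \<subseteq> {nat \<lfloor>x * 2 ^ t\<rfloor>}" by (metis (lifting) nat_int singleton_iff subsetI)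
  then have "card ?J \<le> 1" using card_mono[of "{nat \<lfloor>x * 2 ^ t\<rfloor>}" ?J] by simp
  moreover have "comb t l x = real (card ?J)"
    unfolding comb_def by (simp add: indicator_def sum.If_cases lessThan_def Int_def)
  ultimately show ?thesis by simp
qed

lemma has_bochner_integral_comb:
  "has_bochner_integral lborel (comb t l) (2 ^ t / 2 ^ l)"
proof -
  have "has_bochner_integral lborel (\<lambda>x. \<Sum>j<2 ^ t. indicator {real j / 2 ^ t..<real j / 2 ^ t + 1 / 2 ^ l} x)
      (\<Sum>j<(2::nat) ^ t. 1 / 2 ^ l :: real)"
    by (intro has_bochner_integral_sum) (simp add: has_bochner_integral_iff)
  then show ?thesis unfolding comb_def by simp
qed

lemma integral_exp_interval_le:
  fixes a b \<xi> :: real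
  assumes "a \<le> b" "\<xi> \<noteq> 0"
  shows "norm (LINT x|lborel. indicator {a..<b} x * exp (- (2 * pi * \<i> * x * \<xi>))) \<le> 1 / \<bar>\<xi>\<bar>"
proof -
  let ?e = "\<lambda>x::real. exp (- (2 * pi * \<i> * x * \<xi>))"
  let ?F = "\<lambda>x::real. ?e x / (- (2 * pi * \<i> * \<xi>))"
  have "(LINT x|lborel. indicator {a..<b} x * ?e x) = (LINT x|lborel. indicator {a..b} x *\<^sub>R ?e x)"
    using AE_lborel_singleton[of b]
    by (intro integral_cong_AE) (auto elim!: eventually_mono simp: indicator_def)
  also have "\<dots> = ?F b - ?F a"
  proof (rule integral_FTC_atLeastAtMost)
    show "continuous_on {a..b} ?e" by (intro continuous_intros)
    show "(?F has_vector_derivative ?e x) (at x within {a..b})" if "a \<le> x" "x \<le> b" for x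
    proof -
      have "((\<lambda>z. exp (- (2 * pi * \<i> * z * \<xi>)) / (- (2 * pi * \<i> * \<xi>))) has_field_derivative ?e x) (at (of_real x))"
        using assms(2) by (auto intro!: derivative_eq_intros)
      then show ?thesis
        using has_vector_derivative_real_field has_vector_derivative_at_within by blast
    qed
  qed fact
  also have "norm \<dots> \<le> norm (?F b) + norm (?F a)" by (rule norm_triangle_ineq4)
  also have "\<dots> = 1 / (pi * \<bar>\<xi>\<bar>)"
    by (simp add: norm_divide norm_mult field_simps)
  also have "\<dots> \<le> 1 / \<bar>\<xi>\<bar>"
    using assms(2) pi_gt3 by (intro divide_left_mono) auto
  finally show ?thesis .
qed

lemma integrable_mult_exp:
  fixes f :: "real \<Rightarrow> real" and \<xi> :: real
  assumes "integrable lborel f"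
  shows "integrable lborel (\<lambda>x. complex_of_real (f x) * exp (- (2 * pi * \<i> * x * \<xi>)))"
proof (rule Bochner_Integration.integrable_bound[OF assms])
  show "(\<lambda>x. complex_of_real (f x) * exp (- (2 * pi * \<i> * x * \<xi>))) \<in> borel_measurable lborel"
    using borel_measurable_integrable[OF assms] by measurable
qed (simp add: norm_mult)

text \<open>Each tooth contributes at most \<open>1 / \<bar>\<xi>\<bar>\<close>, and the triangle
  inequality adds up the \<open>2 ^ t\<close> teeth. Losing the cancellation between teeth is
  affordable because the combs used later have few of them.\<close>

lemma norm_fourier_comb_le:
  assumes "\<xi> \<noteq> 0"
  shows "norm (LINT x|lborel. comb t l x * exp (- (2 * pi * \<i> * x * \<xi>))) \<le> 2 ^ t / \<bar>\<xi>\<bar>"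
proof -
  let ?I = "\<lambda>j x. indicator {real j / 2 ^ t..<real j / 2 ^ t + 1 / 2 ^ l} x"
  have "(LINT x|lborel. comb t l x * exp (- (2 * pi * \<i> * x * \<xi>)))
     = (LINT x|lborel. (\<Sum>j<2 ^ t. complex_of_real (?I j x) * exp (- (2 * pi * \<i> * x * \<xi>))))"
    unfolding comb_def by (simp only: of_real_sum sum_distrib_right)
  also have "\<dots> = (\<Sum>j<2 ^ t. LINT x|lborel. complex_of_real (?I j x) * exp (- (2 * pi * \<i> * x * \<xi>)))"
    by (intro Bochner_Integration.integral_sum integrable_mult_exp) simp
  also have "norm \<dots> \<le> (\<Sum>j<(2::nat) ^ t. 1 / \<bar>\<xi>\<bar>)"
    using integral_exp_interval_le[OF _ assms] 
    by (intro sum_norm_le) (simp add: of_real_indicator)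
  finally show ?thesis by simp
qed

text \<open>The first bound only uses that the comb is at most 1, and is good for very small radii;
  the second counts the teeth that meet the ball.\<close>

lemma integral_comb_ball_le:
  assumes "t \<le> l" "r > 0"
  shows "(LINT y|lborel. comb t l y * indicator (ball x r) y) \<le> 2 * r"
    and "(LINT y|lborel. comb t l y * indicator (ball x r) y) \<le> (2 * r * 2 ^ t + 2) / 2 ^ l"
proof -
  have "(LINT y|lborel. comb t l y * indicator (ball x r) y) \<le> (LINT y|lborel. indicator (ball x r) y)"
    using comb_le_1[OF assms(1)] comb_nonneg
    using emeasure_lborel_ball_finite[of x r]
    by (intro integral_mono' integrable_real_indicator) (auto split: split_indicator)
  then show "(LINT y|lborel. comb t l y * indicator (ball x r) y) \<le> 2 * r"
    using assms by (simp add: ball_eq_greaterThanLessThan)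
next
  let ?I = "\<lambda>j. {real j / 2 ^ t..<real j / 2 ^ t + 1 / 2 ^ l}"
  \<comment> \<open>Indices of the teeth that can meet the ball. The lower end is shifted by 1
    because a tooth starting up to one spacing to the left of the ball may still reach it; this
    shift and the rounding in the count give the summand 2.\<close>
  let ?J = "{j::nat. (x - r) * 2 ^ t - 1 < real j \<and> real j < (x + r) * 2 ^ t}"
  have tl: "1 / 2 ^ l \<le> (1 / 2 ^ t :: real)"
    using assms by (intro divide_left_mono) auto
  have fm: "emeasure lborel (?I j \<inter> ball x r) < \<infinity>" for j
    by (rule le_less_trans[OF emeasure_mono[of _ "?I j"]]) auto
  have fin: "finite ?J"
    by (rule finite_subset[of _ "{..nat \<lceil>(x + r) * 2 ^ t\<rceil>}"]) (auto, linarith)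
  have "(LINT y|lborel. comb t l y * indicator (ball x r) y)
      = (LINT y|lborel. (\<Sum>j<2 ^ t. indicator (?I j \<inter> ball x r) y))"
    unfolding comb_def by (simp add: sum_distrib_right indicator_inter_arith)
  also have "\<dots> = (\<Sum>j<2 ^ t. measure lborel (?I j \<inter> ball x r))"
    using fm by (subst Bochner_Integration.integral_sum) (auto intro!: integrable_real_indicator)
  also have "\<dots> \<le> (\<Sum>j<2 ^ t. if j \<in> ?J then 1 / 2 ^ l else 0)"
  proof (rule sum_mono)
    fix j :: nat
    show "measure lborel (?I j \<inter> ball x r) \<le> (if j \<in> ?J then 1 / 2 ^ l else 0)"
    proof (cases "j \<in> ?J")
      case True
      have "measure lborel (?I j \<inter> ball x r) \<le> measure lborel (?I j)"
        by (intro measure_mono_fmeasurable) (auto simp: fmeasurable_def)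
      then show ?thesis using True by simp
    next
      case False
      have "?I j \<inter> ball x r = {}"
      proof (rule ccontr)
        assume "?I j \<inter> ball x r \<noteq> {}"
        then obtain y where "real j / 2 ^ t \<le> y" "y < real j / 2 ^ t + 1 / 2 ^ l" "x - r < y" "y < x + r"
          by (auto simp: ball_eq_greaterThanLessThan)
        then have "real j / 2 ^ t < x + r" "x - r < real j / 2 ^ t + 1 / 2 ^ t"
          using tl by linarith+
        then have "j \<in> ?J" by (simp add: field_simps)
        with False show False by simp
      qed
      then show ?thesis using False by simp
    qed
  qed
  also have "\<dots> \<le> real (card ?J) / 2 ^ l"
    using card_mono[OF fin, of "{..<2 ^ t} \<inter> ?J"]
    by (simp add: sum.If_cases divide_right_mono)
  also have "\<dots> \<le> (2 * r * 2 ^ t + 2) / 2 ^ l"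
    using card_nat_between_le[of "(x - r) * 2 ^ t - 1" "(x + r) * 2 ^ t"] assms
    by (intro divide_right_mono) (auto simp: algebra_simps)
  finally show "(LINT y|lborel. comb t l y * indicator (ball x r) y) \<le> (2 * r * 2 ^ t + 2) / 2 ^ l" .
qed

text \<open>Near a multiple of \<open>2 ^ s\<close> all teeth interfere constructively:
  \<open>j / 2 ^ t\<close> times \<open>i * 2 ^ s\<close> is an integer since
  \<open>t \<le> s\<close>, so \<open>x * \<xi>\<close> is an integer up to a small phase and the
  real part of the integrand is at least half the comb.\<close>

lemma norm_fourier_comb_ge:
  fixes i s t l :: nat and \<eta> \<xi> :: real
  assumes "t \<le> s" "\<xi> = real i * 2 ^ s + \<eta>" "0 \<le> \<eta>" "\<eta> \<le> 1 / 16" "\<xi> / 2 ^ l \<le> 1 / 16"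
  shows "2 ^ t / 2 ^ l / 2 \<le> norm (LINT x|lborel. comb t l x * exp (- (2 * pi * \<i> * x * \<xi>)))"
proof -
  have int: "integrable lborel (comb t l)" "integral\<^sup>L lborel (comb t l) = 2 ^ t / 2 ^ l"
    using has_bochner_integral_comb[of t l] by (auto simp: has_bochner_integral_iff)
  have cos_ge: "1 / 2 \<le> cos (2 * pi * x * \<xi>)" if "comb t l x \<noteq> 0" for x
  proof -
    from that obtain j where j: "j < 2 ^ t" "real j / 2 ^ t \<le> x" "x < real j / 2 ^ t + 1 / 2 ^ l"
      by (rule comb_nonzeroE)
    define y where "y = x - real j / 2 ^ t"
    have y: "0 \<le> y" "y \<le> 1 / 2 ^ l" using j by (auto simp: y_def)
    have \<xi>0: "0 \<le> \<xi>" using assms by simp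
    \<comment> \<open>The phase left after removing the integer. The offset of \<xi> from the
      multiple and the width of the tooth contribute at most 1/16 each.\<close>
    define \<theta> where "\<theta> = real j / 2 ^ t * \<eta> + y * \<xi>"
    have "real j < 2 ^ t" using j(1) by (metis of_nat_less_iff of_nat_numeral of_nat_power)
    then have "real j / 2 ^ t * \<eta> \<le> 1 * (1 / 16)"
      using assms by (intro mult_mono) auto
    moreover have "y * \<xi> \<le> 1 / 2 ^ l * \<xi>" using y \<xi>0 by (intro mult_right_mono)
    ultimately have \<theta>: "0 \<le> \<theta>" "\<theta> \<le> 1 / 8"
      using assms(3,5) y \<xi>0 unfolding \<theta>_def by (simp, simp only: mult_1 times_divide_eq_left)
    have "real j / 2 ^ t * (real i * 2 ^ s) = real (j * i * 2 ^ (s - t))"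
      using power_add[of "2::real" "s - t" t] assms(1) by (simp add: field_simps)
    then have "x * \<xi> = \<theta> + real (j * i * 2 ^ (s - t))"
      unfolding \<theta>_def y_def assms(2) by (simp add: algebra_simps)
    then have "2 * pi * x * \<xi> = 2 * pi * \<theta> + 2 * pi * real (j * i * 2 ^ (s - t))"
      by (metis distrib_left mult.assoc)
    then have "cos (2 * pi * x * \<xi>) = cos (2 * pi * \<theta>)"
      using cos_2npi[of "j * i * 2 ^ (s - t)"] sin_2npi[of "j * i * 2 ^ (s - t)"]
      by (simp only: cos_add mult.commute mult.left_commute mult_1_right mult_zero_right diff_zero)
        (simp add: cos_add mult_ac)
    \<comment> \<open>\<open>\<theta> \<le> 1 / 8\<close> keeps the angle at most
      \<open>pi / 4\<close>, hence below \<open>pi / 3\<close>, where the cosine is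
      \<open>1 / 2\<close>.\<close>
    also have "\<dots> \<ge> cos (pi / 3)"
      using \<theta> by (intro cos_monotone_0_pi_le) (auto simp: field_simps)
    finally show ?thesis by (simp add: cos_60)
  qed
  have ie: "integrable lborel (\<lambda>x. complex_of_real (comb t l x) * exp (- (2 * pi * \<i> * x * \<xi>)))"
    by (rule integrable_mult_exp[OF int(1)])
  have "2 ^ t / 2 ^ l / 2 = (LINT x|lborel. comb t l x * (1 / 2))"
    using int by simp
  also have "\<dots> \<le> (LINT x|lborel. Re (comb t l x * exp (- (2 * pi * \<i> * x * \<xi>))))"
  proof (rule integral_mono)
    show "comb t l x * (1 / 2) \<le> Re (comb t l x * exp (- (2 * pi * \<i> * x * \<xi>)))" for x
      using cos_ge[of x] comb_nonneg[of t l x] 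
      by (cases "comb t l x = 0") (auto simp: Re_exp intro!: mult_left_mono)
    show "integrable lborel (\<lambda>x. Re (comb t l x * exp (- (2 * pi * \<i> * x * \<xi>))))"
      using ie by (rule integrable_Re)
  qed (use int in simp)
  also have "\<dots> = Re (LINT x|lborel. comb t l x * exp (- (2 * pi * \<i> * x * \<xi>)))"
    using ie by (rule integral_Re)
  also have "\<dots> \<le> norm (LINT x|lborel. comb t l x * exp (- (2 * pi * \<i> * x * \<xi>)))"
    by (rule complex_Re_le_cmod)
  finally show ?thesis .
qed

section \<open>Superposition of countably many densities, and extraction of a single one\<close>

locale density_pieces =
  fixes g :: "nat \<Rightarrow> real \<Rightarrow> real"
  assumes piece_nonneg: "\<And>l x. 0 \<le> g l x"
    and piece_integrable: "\<And>l. integrable lborel (g l)"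
    and mass_summable: "summable (\<lambda>l. integral\<^sup>L lborel (g l))"
begin

definition total :: "real \<Rightarrow> real" where
  "total x = (\<Sum>l. g l x)"

definition superposition :: "real measure" where
  "superposition = density lborel (\<lambda>x. ennreal (total x))"

text \<open>
  The quotient is chosen so that \<open>weight l\<close> times the superposition is the \<open>l\<close>-th piece alone.
  The guard keeps it in \<open>{0..1}\<close> also on the null set where the series diverges and \<open>total\<close> is a
  junk value.
\<close>
definition weight :: "nat \<Rightarrow> real \<Rightarrow> real" where
  "weight l x = (if g l x \<le> total x then g l x / total x else 0)"

lemma piece_measurable [measurable]: "g l \<in> borel_measurable borel"
  using borel_measurable_integrable[OF piece_integrable[of l]] by simp

lemma total_measurable [measurable]: "total \<in> borel_measurable borel"
  unfolding total_def by measurable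

lemma weight_measurable [measurable]: "weight l \<in> borel_measurable borel"
  unfolding weight_def by measurable

lemma sets_superposition [simp, measurable_cong]: "sets superposition = sets borel"
  and space_superposition [simp]: "space superposition = UNIV"
  by (simp_all add: superposition_def)

text \<open>By Tonelli the \<open>ennreal\<close> series has a finite integral, so it is finite
  almost everywhere. Since \<open>total\<close> has an arbitrary value where the series diverges,
  its comparison with the pieces is made almost everywhere.\<close>

lemma AE_summable: "AE x in lborel. summable (\<lambda>l. g l x)"
proof -
  have "(\<integral>\<^sup>+ x. (\<Sum>l. ennreal (g l x)) \<partial>lborel) = (\<Sum>l. ennreal (integral\<^sup>L lborel (g l)))"
    using piece_nonneg piece_integrable by (simp add: nn_integral_suminf nn_integral_eq_integral)
  also have "\<dots> < \<infinity>"
    by (subst suminf_ennreal2[OF integral_nonneg_AE mass_summable]) (auto simp: piece_nonneg)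
  finally have "AE x in lborel. (\<Sum>l. ennreal (g l x)) \<noteq> \<infinity>"
    by (intro nn_integral_PInf_AE) auto
  then show ?thesis
    by eventually_elim (auto intro: summable_suminf_not_top piece_nonneg)
qed

lemma AE_piece_le_total: "AE x in lborel. \<forall>l. g l x \<le> total x"
  using AE_summable
proof eventually_elim
  case (elim x)
  show ?case
  proof
    show "g l x \<le> total x" for l
      using sum_le_suminf[OF elim, of "{l}"] piece_nonneg by (simp add: total_def)
  qed
qed

lemma AE_total_nonneg: "AE x in lborel. 0 \<le> total x"
  using AE_piece_le_total by eventually_elim (meson order_trans piece_nonneg)

text \<open>Division by zero does no harm: where \<open>total x = 0\<close>, the piece is squeezed
  between 0 and 0.\<close>

lemma AE_weight_total: "AE x in lborel. \<forall>l. total x * weight l x = g l x"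
  using AE_piece_le_total
proof eventually_elim
  case (elim x)
  then show ?case
    using piece_nonneg[of _ x] by (auto simp: weight_def) (metis order_antisym)
qed

lemma weight_bounds: "0 \<le> weight l x" "weight l x \<le> 1"
  using piece_nonneg[of l x] by (auto simp: weight_def divide_le_eq)

lemma integrable_piece_indicator:
  assumes "A \<in> sets borel"
  shows "integrable lborel (\<lambda>x. g l x * indicator A x)"
  using assms by (intro integrable_real_mult_indicator piece_integrable) simp

lemma emeasure_superposition_eq:
  assumes "A \<in> sets borel"
  shows "emeasure superposition A = (\<Sum>l. ennreal (LINT x|lborel. g l x * indicator A x))"
proof -
  have "emeasure superposition A = (\<integral>\<^sup>+ x. ennreal (total x) * indicator A x \<partial>lborel)"
    using assms by (simp add: superposition_def emeasure_density)
  also have "\<dots> = (\<integral>\<^sup>+ x. (\<Sum>l. ennreal (g l x * indicator A x)) \<partial>lborel)"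
    using AE_summable
    by (intro nn_integral_cong_AE, eventually_elim)
      (auto simp: total_def suminf_ennreal2[OF piece_nonneg] split: split_indicator)
  also have "\<dots> = (\<Sum>l. ennreal (LINT x|lborel. g l x * indicator A x))"
    using assms piece_nonneg
    by (subst nn_integral_suminf)
      (auto intro!: suminf_cong nn_integral_eq_integral integrable_piece_indicator)
  finally show ?thesis .
qed

lemma emeasure_superposition_le:
  assumes "A \<in> sets borel" "\<And>l. (LINT x|lborel. g l x * indicator A x) \<le> b l" "summable b"
  shows "emeasure superposition A \<le> ennreal (suminf b)"
proof -
  have nonneg: "0 \<le> (LINT x|lborel. g l x * indicator A x)" for l
    using piece_nonneg by (intro integral_nonneg_AE) auto
  have summable: "summable (\<lambda>l. LINT x|lborel. g l x * indicator A x)"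
    using assms nonneg by (intro summable_comparison_test'[OF assms(3), of 0]) auto
  have "emeasure superposition A = ennreal (\<Sum>l. LINT x|lborel. g l x * indicator A x)"
    unfolding emeasure_superposition_eq[OF assms(1)]
    using nonneg summable by (intro suminf_ennreal2)
  also have "\<dots> \<le> ennreal (suminf b)"
    using assms summable by (intro ennreal_leI suminf_le)
  finally show ?thesis .
qed

lemma finite_borel_measure_superposition: "finite_borel_measure superposition"
proof -
  have "emeasure superposition UNIV \<le> ennreal (\<Sum>l. integral\<^sup>L lborel (g l))"
    by (intro emeasure_superposition_le mass_summable) auto
  then have "finite_measure superposition"
    by (intro finite_measureI) (auto simp: top_unique)
  then show ?thesis
    by (simp add: finite_borel_measure_def finite_borel_measure_axioms_def)
qed

lemma mass_le_emeasure_superposition: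
  "ennreal (integral\<^sup>L lborel (g l)) \<le> emeasure superposition UNIV"
  using sum_le_suminf[of "\<lambda>l. ennreal (integral\<^sup>L lborel (g l))" "{l}"]
  by (simp add: emeasure_superposition_eq)

lemma integral_superposition:
  fixes F :: "real \<Rightarrow> complex"
  assumes "F \<in> borel_measurable borel"
  shows "(LINT x|superposition. F x) = (LINT x|lborel. total x * F x)"
proof -
  have "F \<in> borel_measurable lborel" using assms by simp
  then show ?thesis
    unfolding superposition_def using AE_total_nonneg
    by (simp add: integral_density scaleR_conv_of_real)
qed

text \<open>Isolates one scale: with \<open>weight l\<close> as test function, a lower bound for the
  transform of the \<open>l\<close>-th piece applies to the whole measure.\<close>

lemma fourier_superposition_weight:
  "fourier_measure superposition (\<lambda>x. weight l x) \<xi>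
    = (LINT x|lborel. g l x * exp (- (2 * pi * \<i> * x * \<xi>)))"
proof -
  have "fourier_measure superposition (\<lambda>x. weight l x) \<xi>
      = (LINT x|lborel. total x * (weight l x * exp (- (2 * pi * \<i> * x * \<xi>))))"
    unfolding fourier_measure_def by (rule integral_superposition) measurable
  also have "\<dots> = (LINT x|lborel. g l x * exp (- (2 * pi * \<i> * x * \<xi>)))"
    using AE_weight_total
  proof (intro integral_cong_AE, measurable, eventually_elim)
    case (elim x)
    then have "complex_of_real (total x) * complex_of_real (weight l x) = complex_of_real (g l x)"
      by (simp flip: of_real_mult)
    then show ?case by (simp flip: mult.assoc)
  qed
  finally show ?thesis .
qed

text \<open>The exponential has norm 1, so the summable masses allow the exchange of integral and
  series, and the bounds for the pieces add up.\<close>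

lemma norm_fourier_superposition_le:
  assumes "\<And>l. norm (LINT x|lborel. g l x * exp (- (2 * pi * \<i> * x * \<xi>))) \<le> b l" "summable b"
  shows "norm (fourier_measure superposition (\<lambda>_. 1) \<xi>) \<le> suminf b"
proof -
  let ?e = "\<lambda>x::real. exp (- (2 * pi * \<i> * x * \<xi>))"
  have "fourier_measure superposition (\<lambda>_. 1) \<xi> = (LINT x|lborel. total x * ?e x)"
    unfolding fourier_measure_def by (subst integral_superposition) (auto simp: mult_ac)
  also have "\<dots> = (LINT x|lborel. (\<Sum>l. g l x * ?e x))"
    using AE_summable
  proof (intro integral_cong_AE, measurable, eventually_elim)
    case (elim x)
    then show ?case
      by (simp add: total_def suminf_of_real suminf_mult2 summable_of_real)
  qed
  also have "\<dots> = (\<Sum>l. LINT x|lborel. g l x * ?e x)"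
  proof (rule integral_suminf)
    show "integrable lborel (\<lambda>x. g l x * ?e x)" for l
      by (intro integrable_mult_exp piece_integrable)
    show "AE x in lborel. summable (\<lambda>l. norm (g l x * ?e x))"
      using AE_summable by eventually_elim (simp add: norm_mult piece_nonneg)
    show "summable (\<lambda>l. LINT x|lborel. norm (g l x * ?e x))"
      using mass_summable by (simp add: norm_mult piece_nonneg)
  qed
  also have "norm \<dots> \<le> suminf b"
    using assms by (intro norm_suminf_le) auto
  finally show ?thesis .
qed

lemma nn_integral_weight:
  "(\<integral>\<^sup>+ x. ennreal (norm (complex_of_real (weight l x)) powr p) \<partial>superposition)
    = (\<integral>\<^sup>+ x. ennreal (total x * weight l x powr p) \<partial>lborel)"
  unfolding superposition_def using AE_total_nonneg
  by (subst nn_integral_density)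
    (auto simp: ennreal_mult'' weight_bounds intro!: nn_integral_cong_AE)

text \<open>As \<open>weight l\<close> lies between 0 and 1 and \<open>1 < p\<close>, its
  \<open>p\<close>-th power is at most itself, and its integral against the superposition is the
  mass of the piece. If the norm were 0, the piece would vanish almost everywhere, against its
  positive mass.\<close>

lemma Lp_norm_weight:
  assumes "1 < p" "0 < integral\<^sup>L lborel (g l)"
  shows "0 < Lp_norm p superposition (\<lambda>x. weight l x)"
    and "Lp_norm p superposition (\<lambda>x. weight l x) \<le> ennreal (integral\<^sup>L lborel (g l) powr (1 / p))"
proof -
  define I where "I = (\<integral>\<^sup>+ x. ennreal (norm (complex_of_real (weight l x)) powr p) \<partial>superposition)"
  have I: "I = (\<integral>\<^sup>+ x. ennreal (total x * weight l x powr p) \<partial>lborel)"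
    unfolding I_def by (rule nn_integral_weight)
  have "I \<le> (\<integral>\<^sup>+ x. ennreal (g l x) \<partial>lborel)"
    unfolding I using AE_weight_total AE_total_nonneg
  proof (intro nn_integral_mono_AE, eventually_elim)
    case (elim x)
    have "weight l x powr p \<le> weight l x powr 1"
      using weight_bounds assms by (intro powr_mono') auto
    then have "total x * weight l x powr p \<le> total x * weight l x"
      using elim weight_bounds by (intro mult_left_mono) auto
    also have "\<dots> = g l x" using elim by blast
    finally show ?case by (rule ennreal_leI)
  qed
  also have "\<dots> = ennreal (integral\<^sup>L lborel (g l))"
    using piece_nonneg piece_integrable by (simp add: nn_integral_eq_integral)
  finally have le: "I \<le> ennreal (integral\<^sup>L lborel (g l))" .
  have "I \<noteq> 0"
  proof
    assume "I = 0"
    then have "AE x in lborel. ennreal (total x * weight l x powr p) = 0"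
      unfolding I by (subst (asm) nn_integral_0_iff_AE) auto
    then have "AE x in lborel. g l x = 0"
      using AE_weight_total AE_total_nonneg
    proof eventually_elim
      case (elim x)
      then have "total x * weight l x powr p \<le> 0" by (simp add: ennreal_eq_0_iff)
      then have "total x = 0 \<or> weight l x = 0"
        using elim(3) weight_bounds(1)[of l x] by (auto simp: mult_le_0_iff powr_eq_0_iff)
      then show ?case using elim(2) by (metis mult_eq_0_iff)
    qed
    then have "integral\<^sup>L lborel (g l) = 0" by (rule integral_eq_zero_AE)
    with assms show False by simp
  qed
  moreover have "I \<noteq> \<infinity>" using le by (auto simp: top_unique)
  ultimately have pos: "0 < enn2real I" by (simp add: enn2real_positive_iff less_top zero_less_iff_neq_zero)
  have norm_eq: "Lp_norm p superposition (\<lambda>x. weight l x) = ennreal (enn2real I powr (1 / p))"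
    using \<open>I \<noteq> \<infinity>\<close> by (simp add: Lp_norm_def I_def)
  show "0 < Lp_norm p superposition (\<lambda>x. weight l x)"
    unfolding norm_eq using pos by simp
  show "Lp_norm p superposition (\<lambda>x. weight l x) \<le> ennreal (integral\<^sup>L lborel (g l) powr (1 / p))"
    unfolding norm_eq using le assms
    by (intro ennreal_leI powr_mono2) (auto intro!: enn2real_leI)
qed

end

section \<open>Combs scaled to the exponent \<open>a\<close>: mass, ball and Fourier bounds\<close>

lemma summable_powr_geometric:
  assumes "0 < c"
  shows "summable (\<lambda>l::nat. 2 powr - (c * real l))"
proof -
  have "(\<lambda>l::nat. 2 powr - (c * real l)) = (\<lambda>l. (2 powr - c) ^ l)"
    by (simp add: powr_power mult.commute fun_eq_iff)
  moreover have "2 powr - c < 1"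
    using assms powr_less_cancel_iff[of 2 "- c" 0] by simp
  ultimately show ?thesis by (simp add: summable_geometric)
qed

definition level :: "real \<Rightarrow> nat \<Rightarrow> nat" where
  "level a l = nat \<lfloor>a * real l / 2\<rfloor>"

text \<open>The height is chosen so that each tooth, of length \<open>1 / 2 ^ l\<close>, has mass
  \<open>2 powr - (a * real l)\<close>.\<close>

definition comb_piece :: "real \<Rightarrow> nat \<Rightarrow> real \<Rightarrow> real" where
  "comb_piece a l x = 2 powr (real l * (1 - a)) * comb (level a l) l x"

definition comb_mass :: "real \<Rightarrow> nat \<Rightarrow> real" where
  "comb_mass a l = 2 ^ level a l * 2 powr - (a * real l)"

lemma powr_div_power: "2 powr (real l * (1 - a)) / 2 ^ l = 2 powr - (a * real l)"
  by (simp add: powr_realpow[symmetric] powr_diff[symmetric] algebra_simps)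

lemma level_mono: "a \<le> b \<Longrightarrow> level a l \<le> level b l"
  unfolding level_def by (intro nat_mono floor_mono) (simp add: mult_right_mono)

lemma power_level_le:
  assumes "0 < a"
  shows "2 ^ level a l \<le> 2 powr (a * real l / 2)"
proof -
  have "real (level a l) \<le> a * real l / 2"
    using assms of_int_floor_le[of "a * real l / 2"] by (simp add: level_def del: of_int_floor_le)
  then show ?thesis by (simp add: powr_realpow[symmetric])
qed

lemma power_level_ge: "2 powr (a * real l / 2 - 1) \<le> 2 ^ level a l"
proof -
  have "a * real l / 2 - 1 \<le> real (level a l)"
    unfolding level_def by linarith
  then show ?thesis by (simp add: powr_realpow[symmetric])
qed

lemma level_le:
  assumes "0 < a" "a < 2"
  shows "level a l \<le> l"
proof -
  have "a * real l \<le> 2 * real l" using assms by (intro mult_right_mono) auto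
  then have "\<lfloor>a * real l / 2\<rfloor> \<le> int l" by linarith
  then show ?thesis by (simp add: level_def)
qed

lemma comb_mass_pos: "0 < comb_mass a l"
  by (simp add: comb_mass_def)

lemma comb_mass_le:
  assumes "0 < a"
  shows "comb_mass a l \<le> 2 powr - (a / 2 * real l)"
proof -
  have "comb_mass a l \<le> 2 powr (a * real l / 2) * 2 powr - (a * real l)"
    unfolding comb_mass_def using power_level_le[OF assms] by (intro mult_right_mono) auto
  also have "\<dots> = 2 powr - (a / 2 * real l)" by (simp flip: powr_add)
  finally show ?thesis .
qed

lemma comb_mass_ge: "2 powr (- (a * real l / 2) - 1) \<le> comb_mass a l"
proof -
  have "2 powr (- (a * real l / 2) - 1) = 2 powr (a * real l / 2 - 1) * 2 powr - (a * real l)"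
    by (simp flip: powr_add)
  also have "\<dots> \<le> comb_mass a l"
    unfolding comb_mass_def using power_level_ge by (intro mult_right_mono) auto
  finally show ?thesis .
qed

lemma has_bochner_integral_comb_piece:
  "has_bochner_integral lborel (comb_piece a l) (comb_mass a l)"
proof -
  have "has_bochner_integral lborel (comb_piece a l)
      (2 powr (real l * (1 - a)) * (2 ^ level a l / 2 ^ l))"
    unfolding comb_piece_def by (intro has_bochner_integral_mult_right has_bochner_integral_comb)
  also have "2 powr (real l * (1 - a)) * (2 ^ level a l / 2 ^ l) = comb_mass a l"
    unfolding comb_mass_def powr_div_power[symmetric] by simp
  finally show ?thesis .
qed

lemma integral_comb_piece: "integral\<^sup>L lborel (comb_piece a l) = comb_mass a l"
  using has_bochner_integral_comb_piece by (simp add: has_bochner_integral_iff)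

lemma comb_piece_nonneg: "0 \<le> comb_piece a l x"
  by (simp add: comb_piece_def comb_nonneg)

lemma density_pieces_comb:
  assumes "0 < a"
  shows "density_pieces (comb_piece a)"
proof
  show "summable (\<lambda>l. integral\<^sup>L lborel (comb_piece a l))"
    unfolding integral_comb_piece using comb_mass_le[OF assms] comb_mass_pos assms
    by (intro summable_comparison_test'[OF summable_powr_geometric[of "a / 2"], of 0])
      (simp_all add: abs_of_pos)
qed (use has_bochner_integral_comb_piece in \<open>auto simp: comb_piece_nonneg has_bochner_integral_iff\<close>)

text \<open>For \<open>1 \<le> r\<close> the whole mass of the piece suffices. For smaller
  \<open>r\<close> the count of teeth gives a term proportional to \<open>r\<close>, which is at
  most \<open>r powr \<alpha>\<close>, plus the mass of two teeth, which is improved by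
  interpolation with the bound by height.\<close>

lemma integral_comb_piece_ball_le:
  assumes "0 < \<alpha>" "\<alpha> < 1" "\<alpha> < a" "a < 2" "0 < r"
  shows "(LINT y|lborel. comb_piece a l y * indicator (ball x r) y)
    \<le> 2 * r powr \<alpha> * (2 powr - (a / 2 * real l) + 2 powr - ((a - \<alpha>) * real l))"
    (is "?z \<le> _")
proof (cases "1 \<le> r")
  case True
  have int: "integrable lborel (comb_piece a l)"
    using has_bochner_integral_comb_piece by (simp add: has_bochner_integral_iff)
  have "?z \<le> integral\<^sup>L lborel (comb_piece a l)"
    using int comb_piece_nonneg[of a l] by (intro integral_mono') (auto simp: indicator_def)
  also have "\<dots> \<le> 1 * 2 powr - (a / 2 * real l)"
    using comb_mass_le[of a l] assms by (simp add: integral_comb_piece)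
  also have "\<dots> \<le> 2 * r powr \<alpha> * (2 powr - (a / 2 * real l) + 2 powr - ((a - \<alpha>) * real l))"
    using True assms ge_one_powr_ge_zero[of r \<alpha>] by (intro mult_mono) auto
  finally show ?thesis .
next
  case False
  define w where "w = 2 powr (real l * (1 - a))"
  define t where "t = level a l"
  have z: "?z = w * (LINT y|lborel. comb t l y * indicator (ball x r) y)"
    by (simp add: comb_piece_def w_def t_def mult.assoc)
  have tl: "t \<le> l" unfolding t_def using assms by (intro level_le) auto
  have w: "0 < w" "w / 2 ^ l = 2 powr - (a * real l)"
    unfolding w_def using powr_div_power by auto
  have Y: "?z \<le> w * (2 * r)"
    unfolding z using w integral_comb_ball_le(1)[OF tl \<open>0 < r\<close>] by (intro mult_left_mono) auto
  have "?z \<le> w * ((2 * r * 2 ^ t + 2) / 2 ^ l)"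
    unfolding z using w integral_comb_ball_le(2)[OF tl \<open>0 < r\<close>] by (intro mult_left_mono) auto
  also have "\<dots> = (w / 2 ^ l) * (2 * r * 2 ^ t + 2)" by simp
  finally have X: "?z \<le> 2 * r * comb_mass a l + 2 * 2 powr - (a * real l)"
    unfolding w(2) by (simp add: comb_mass_def t_def algebra_simps)
  have "r powr 1 \<le> r powr \<alpha>" using False assms by (intro powr_mono') auto
  then have A: "2 * r * comb_mass a l \<le> 2 * r powr \<alpha> * 2 powr - (a / 2 * real l)"
    using assms comb_mass_le[of a l] comb_mass_pos[of a l] by (intro mult_mono) auto
  have "?z - 2 * r * comb_mass a l \<le> ?z"
    using assms comb_mass_pos[of a l] by simp
  \<comment> \<open>Only the excess over the term proportional to \<open>r\<close> is interpolated,
    cut off at 0 because it may be negative. The exponent \<alpha> produces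
    \<open>r powr \<alpha>\<close> and leaves the factor
    \<open>2 powr - ((a - \<alpha>) * real l)\<close>.\<close>
  then have "max 0 (?z - 2 * r * comb_mass a l)
      \<le> (2 * 2 powr - (a * real l)) powr (1 - \<alpha>) * (w * (2 * r)) powr \<alpha>"
    using X Y assms w(1) by (intro interpolate_le_powr) (auto intro: order_trans)
  also have "\<dots> = (2 powr (1 - \<alpha>) * 2 powr \<alpha>) * r powr \<alpha>
      * (2 powr (- (a * real l) * (1 - \<alpha>)) * 2 powr (real l * (1 - a) * \<alpha>))"
    using assms by (simp add: powr_mult powr_powr w_def mult_ac)
  also have "\<dots> = 2 * r powr \<alpha> * 2 powr - ((a - \<alpha>) * real l)"
    by (simp flip: powr_add add: algebra_simps)
  finally show ?thesis using A by (simp add: algebra_simps)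
qed

lemma fourier_comb_piece:
  "(LINT x|lborel. comb_piece a l x * exp (- (2 * pi * \<i> * x * \<xi>)))
    = 2 powr (real l * (1 - a)) * (LINT x|lborel. comb (level a l) l x * exp (- (2 * pi * \<i> * x * \<xi>)))"
  by (simp add: comb_piece_def mult.assoc)

text \<open>Interpolates between the mass of the piece and the bound height times number of teeth
  over \<open>\<bar>\<xi>\<bar>\<close>. The result is summable over \<open>l\<close> exactly when
  \<open>s < a / 2\<close>.\<close>

lemma norm_fourier_comb_piece_le:
  assumes "0 < a" "0 \<le> s" "s \<le> 1" "\<xi> \<noteq> 0"
  shows "norm (LINT x|lborel. comb_piece a l x * exp (- (2 * pi * \<i> * x * \<xi>)))
    \<le> 2 powr - ((a / 2 - s) * real l) * \<bar>\<xi>\<bar> powr - s" (is "norm ?z \<le> _")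
proof -
  have int: "integrable lborel (comb_piece a l)"
    using has_bochner_integral_comb_piece by (simp add: has_bochner_integral_iff)
  have "norm ?z \<le> (LINT x|lborel. norm (comb_piece a l x * exp (- (2 * pi * \<i> * x * \<xi>))))"
    by (rule integral_norm_bound)
  also have "\<dots> = comb_mass a l"
    by (simp add: norm_mult comb_piece_nonneg integral_comb_piece)
  also have "\<dots> \<le> 2 powr - (a / 2 * real l)" by (rule comb_mass_le) fact
  finally have X: "norm ?z \<le> 2 powr - (a / 2 * real l)" .
  have "norm ?z \<le> 2 powr (real l * (1 - a)) * (2 ^ level a l / \<bar>\<xi>\<bar>)"
    unfolding fourier_comb_piece norm_mult
    using norm_fourier_comb_le[OF assms(4)] by (intro mult_mono) auto
  also have "\<dots> \<le> 2 powr (real l * (1 - a)) * (2 powr (a * real l / 2) / \<bar>\<xi>\<bar>)"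
    using power_level_le[OF assms(1)] by (intro mult_left_mono divide_right_mono) auto
  also have "\<dots> = (2 powr (real l * (1 - a)) * 2 powr (a * real l / 2)) / \<bar>\<xi>\<bar>" by simp
  also have "\<dots> = 2 powr ((1 - a / 2) * real l) / \<bar>\<xi>\<bar>"
    by (simp flip: powr_add add: algebra_simps)
  finally have Y: "norm ?z \<le> 2 powr ((1 - a / 2) * real l) / \<bar>\<xi>\<bar>" .
  have "norm ?z \<le> (2 powr - (a / 2 * real l)) powr (1 - s) * (2 powr ((1 - a / 2) * real l) / \<bar>\<xi>\<bar>) powr s"
    using X Y assms by (intro interpolate_le_powr) auto
  also have "\<dots> = (2 powr (- (a / 2 * real l) * (1 - s)) * 2 powr ((1 - a / 2) * real l * s)) * \<bar>\<xi>\<bar> powr - s"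
    by (simp add: powr_divide powr_powr powr_minus_divide)
  also have "\<dots> = 2 powr - ((a / 2 - s) * real l) * \<bar>\<xi>\<bar> powr - s"
  proof -
    have "- (a / 2 * real l) * (1 - s) + (1 - a / 2) * real l * s = - ((a / 2 - s) * real l)"
      by (simp add: field_simps)
    then show ?thesis by (simp only: powr_add[symmetric])
  qed
  finally show ?thesis .
qed

lemma comb_piece_outside:
  assumes "x \<notin> {0..2}"
  shows "comb_piece a l x = 0"
proof (rule ccontr)
  assume "comb_piece a l x \<noteq> 0"
  then have "comb (level a l) l x \<noteq> 0" by (simp add: comb_piece_def)
  then obtain j where j: "j < 2 ^ level a l" "real j / 2 ^ level a l \<le> x"
      "x < real j / 2 ^ level a l + 1 / 2 ^ l"
    by (rule comb_nonzeroE)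
  have "real j < 2 ^ level a l" using j(1) by (metis of_nat_less_iff of_nat_numeral of_nat_power)
  then have "real j / 2 ^ level a l \<le> 1" by simp
  moreover have "1 / 2 ^ l \<le> (1::real)" by simp
  moreover have "0 \<le> real j / 2 ^ level a l" by simp
  ultimately have "0 \<le> x" "x \<le> 2" using j by linarith+
  then have "x \<in> {0..2}" by simp
  with assms show False by simp
qed

section \<open>The measures and their support, Fourier decay and ball condition\<close>

abbreviation comb_measure :: "real \<Rightarrow> real measure" where
  "comb_measure a \<equiv> density_pieces.superposition (comb_piece a)"

lemma comb_measure_nonzero:
  assumes "0 < a"
  shows "emeasure (comb_measure a) UNIV \<noteq> 0"
proof -
  interpret density_pieces "comb_piece a" by (rule density_pieces_comb) fact
  show ?thesis
    using mass_le_emeasure_superposition[of 0] comb_mass_pos[of a 0]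
    by (auto simp: integral_comb_piece)
qed

lemma supported_on_comb_measure:
  assumes "0 < a"
  shows "supported_on (comb_measure a) {0..2}"
proof -
  interpret density_pieces "comb_piece a" by (rule density_pieces_comb) fact
  have "(\<lambda>x. comb_piece a l x * indicator (- {0..2}) x) = (\<lambda>x. 0)" for l
    using comb_piece_outside[of _ a l] by (force simp: indicator_def)
  then show ?thesis
    unfolding supported_on_def by (subst emeasure_superposition_eq) auto
qed

text \<open>The bounds for the pieces with \<open>s = \<beta> / 2\<close> form a geometric series of
  ratio \<open>2 powr - ((a - \<beta>) / 2)\<close>, which is below 1 because
  \<open>\<beta> < \<alpha> \<le> a\<close>.\<close>

lemma fourier_decay_comb_measure:
  assumes "0 < \<alpha>" "\<alpha> < 1" "\<alpha> \<le> a"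
  shows "fourier_decay (comb_measure a) \<alpha>"
  unfolding fourier_decay_def
proof (intro allI impI)
  interpret density_pieces "comb_piece a" by (rule density_pieces_comb) (use assms in simp)
  fix \<beta> assume \<beta>: "0 \<le> \<beta> \<and> \<beta> < \<alpha>"
  let ?b = "\<lambda>l::nat. 2 powr - ((a / 2 - \<beta> / 2) * real l)"
  have sb: "summable ?b" using \<beta> assms by (intro summable_powr_geometric) simp
  have "norm (fourier_measure superposition (\<lambda>_. 1) \<xi>) \<le> suminf ?b * \<bar>\<xi>\<bar> powr (- \<beta> / 2)"
    if "\<xi> \<noteq> 0" for \<xi>
  proof -
    have "norm (fourier_measure superposition (\<lambda>_. 1) \<xi>) \<le> (\<Sum>l. ?b l * \<bar>\<xi>\<bar> powr - (\<beta> / 2))"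
      using sb \<beta> assms that
      by (intro norm_fourier_superposition_le norm_fourier_comb_piece_le summable_mult2) auto
    also have "\<dots> = suminf ?b * \<bar>\<xi>\<bar> powr (- \<beta> / 2)"
      using suminf_mult2[OF sb, of "\<bar>\<xi>\<bar> powr (- \<beta> / 2)"] by simp
    finally show ?thesis .
  qed
  moreover have "0 < suminf ?b" using sb by (intro suminf_pos) auto
  ultimately show "\<exists>C>0. \<forall>\<xi>. \<xi> \<noteq> 0 \<longrightarrow>
      norm (fourier_measure superposition (\<lambda>_. 1) \<xi>) \<le> C * \<bar>\<xi>\<bar> powr (- \<beta> / 2)"
    by blast
qed

text \<open>Adding the bounds for the pieces gives two geometric series; the second has rate
  \<open>a - \<alpha>\<close> and converges thanks to the strict margin
  \<open>\<alpha> < a\<close>.\<close>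

lemma ball_condition_comb_measure:
  assumes "0 < \<alpha>" "\<alpha> < 1" "\<alpha> < a" "a < 2"
  shows "ball_condition (comb_measure a) E \<alpha>"
proof -
  interpret density_pieces "comb_piece a" by (rule density_pieces_comb) (use assms in simp)
  let ?b = "\<lambda>l::nat. 2 powr - (a / 2 * real l) + 2 powr - ((a - \<alpha>) * real l)"
  have sb: "summable ?b" using assms by (intro summable_add summable_powr_geometric) auto
  have pos: "0 < suminf ?b" using sb by (intro suminf_pos) (auto intro: add_pos_pos)
  have "measure superposition (ball x r) \<le> (2 * suminf ?b) * r powr \<alpha>" if "0 < r" for x r
  proof -
    have "emeasure superposition (ball x r) \<le> ennreal (\<Sum>l. 2 * r powr \<alpha> * ?b l)"
      using assms that sb
      by (intro emeasure_superposition_le integral_comb_piece_ball_le summable_mult) auto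
    also have "(\<Sum>l. 2 * r powr \<alpha> * ?b l) = (2 * suminf ?b) * r powr \<alpha>"
      using suminf_mult[OF sb, of "2 * r powr \<alpha>"] by simp
    finally show ?thesis
      unfolding measure_def using pos by (intro enn2real_leI) auto
  qed
  then show ?thesis
    unfolding ball_condition_def using pos by (intro exI[of _ "2 * suminf ?b"]) auto
qed

section \<open>Frequencies at which all the transforms are large\<close>

text \<open>For \<open>l < 5 + s\<close> the subtraction truncates and only the interval at the origin remains.\<close>
definition frequency_set :: "nat \<Rightarrow> nat \<Rightarrow> real set" where
  "frequency_set s l = (\<Union>i<2 ^ (l - 5 - s). {real i * 2 ^ s..real i * 2 ^ s + 1 / 16})"

lemma sets_frequency_set [measurable]: "frequency_set s l \<in> sets borel"
  unfolding frequency_set_def by measurable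

lemma emeasure_frequency_set:
  "emeasure lborel (frequency_set s l) = ennreal (2 ^ (l - 5 - s) / 16)"
proof -
  let ?I = "\<lambda>i::nat. {real i * 2 ^ s..real i * 2 ^ s + 1 / 16}"
  have "disjoint_family_on ?I {..<2 ^ (l - 5 - s)}"
    unfolding disjoint_family_on_def
  proof (intro ballI impI)
    have *: "?I i \<inter> ?I j = {}" if "i < j" for i j
    proof -
      have "1 * 1 \<le> (real j - real i) * (2 ^ s :: real)"
        using that by (intro mult_mono) auto
      then have "real i * 2 ^ s + 1 \<le> real j * 2 ^ s" by (simp add: algebra_simps)
      then show ?thesis by auto
    qed
    show "?I i \<inter> ?I j = {}" if "i \<noteq> j" for i j
      using *[of i j] *[of j i] that by (cases "i < j") (auto simp: Int_commute)
  qed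
  then have "emeasure lborel (frequency_set s l) = (\<Sum>i<2 ^ (l - 5 - s). emeasure lborel (?I i))"
    unfolding frequency_set_def by (intro sum_emeasure[symmetric]) auto
  also have "\<dots> = (\<Sum>i<(2::nat) ^ (l - 5 - s). ennreal (1 / 16))"
    by (intro sum.cong) auto
  also have "\<dots> = ennreal (2 ^ (l - 5 - s) / 16)"
    by (simp add: ennreal_of_nat_eq_real_of_nat ennreal_mult[symmetric])
  finally show ?thesis .
qed

text \<open>For a non-zero index the 5 in the number of intervals forces
  \<open>\<xi> \<le> 2 ^ l / 32\<close>; for index 0, \<open>\<xi> \<le> 1 / 16\<close> is enough
  for every \<open>l\<close>. Either way the phase across one tooth is small.\<close>

lemma frequency_setE:
  assumes "\<xi> \<in> frequency_set s l"
  obtains i \<eta> where "\<xi> = real i * 2 ^ s + \<eta>" "0 \<le> \<eta>" "\<eta> \<le> 1 / 16" "\<xi> / 2 ^ l \<le> 1 / 16"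
proof -
  obtain i where i: "i < 2 ^ (l - 5 - s)" "real i * 2 ^ s \<le> \<xi>" "\<xi> \<le> real i * 2 ^ s + 1 / 16"
    using assms by (auto simp: frequency_set_def)
  have "\<xi> / 2 ^ l \<le> 1 / 16"
  proof (cases "i = 0")
    case True
    then have "\<xi> \<le> 1 / 16" using i by simp
    moreover have "1 \<le> (2 ^ l :: real)" by simp
    ultimately have "\<xi> \<le> 1 / 16 * 2 ^ l" by linarith
    then show ?thesis by (simp add: divide_le_eq)
  next
    case False
    \<comment> \<open>A non-zero index rules out truncation, so the exponents really add up to
      \<open>l\<close>, with \<open>32 = 2 ^ 5\<close>.\<close>
    then have "l - 5 - s \<noteq> 0" using i(1) by (cases "l - 5 - s") auto
    then have eq: "(2::real) ^ l = 2 ^ (l - 5 - s) * 2 ^ s * 32"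
      using power_add[of "2::real" "l - 5 - s + s" 5] power_add[of "2::real" "l - 5 - s" s] by simp
    have "real (i + 1) \<le> real (2 ^ (l - 5 - s))" using i(1) by (intro of_nat_mono) simp
    then have "(real i + 1) * 2 ^ s \<le> 2 ^ (l - 5 - s) * (2 ^ s :: real)"
      by (intro mult_right_mono) auto
    moreover have "(1::real) \<le> 2 ^ s" by simp
    ultimately have "\<xi> \<le> 2 ^ (l - 5 - s) * 2 ^ s" using i(3) unfolding distrib_right by linarith
    then have "\<xi> \<le> 2 ^ (l - 5 - s) * 2 ^ s * 2"
      by (rule order_trans) simp
    then show ?thesis unfolding eq by (simp add: field_simps)
  qed
  then show ?thesis using that[of i "\<xi> - real i * 2 ^ s"] i by simp
qed

lemma norm_fourier_comb_piece_ge: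
  assumes "level a l \<le> s" "\<xi> \<in> frequency_set s l"
  shows "comb_mass a l / 2 \<le> norm (LINT x|lborel. comb_piece a l x * exp (- (2 * pi * \<i> * x * \<xi>)))"
proof -
  obtain i \<eta> where "\<xi> = real i * 2 ^ s + \<eta>" "0 \<le> \<eta>" "\<eta> \<le> 1 / 16" "\<xi> / 2 ^ l \<le> 1 / 16"
    using assms(2) by (rule frequency_setE)
  note comb_ge = norm_fourier_comb_ge[OF assms(1) this]
  have "comb_mass a l / 2 = 2 powr (real l * (1 - a)) * (2 ^ level a l / 2 ^ l / 2)"
    unfolding comb_mass_def powr_div_power[symmetric] by simp
  also have "\<dots> \<le> 2 powr (real l * (1 - a))
      * norm (LINT x|lborel. comb (level a l) l x * exp (- (2 * pi * \<i> * x * \<xi>)))"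
    by (intro mult_left_mono comb_ge) auto
  finally show ?thesis unfolding fourier_comb_piece by (simp add: norm_mult)
qed

section \<open>Lower bound for the quotient of norms\<close>

text \<open>Chebyshev's inequality. An infinite integral is treated separately because
  \<open>enn2real\<close> would send it to 0.\<close>

lemma Lp_norm_ge:
  assumes "F \<in> sets M" "ennreal v \<le> emeasure M F" "0 \<le> v" "0 \<le> c" "0 < q"
    and "\<And>x. x \<in> F \<Longrightarrow> c \<le> norm (H x)"
  shows "ennreal (c * v powr (1 / q)) \<le> Lp_norm q M H"
proof -
  define I where "I = (\<integral>\<^sup>+ x. ennreal (norm (H x) powr q) \<partial>M)"
  have "ennreal (c powr q * v) = ennreal (c powr q) * ennreal v"
    using assms by (simp add: ennreal_mult)
  also have "\<dots> \<le> ennreal (c powr q) * emeasure M F"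
    using assms by (intro mult_left_mono) auto
  also have "\<dots> = (\<integral>\<^sup>+ x. ennreal (c powr q) * indicator F x \<partial>M)"
    using assms by (simp add: nn_integral_cmult_indicator)
  also have "\<dots> \<le> I"
    unfolding I_def using assms
    by (intro nn_integral_mono) (auto intro!: ennreal_leI powr_mono2 split: split_indicator)
  finally have I: "ennreal (c powr q * v) \<le> I" .
  show ?thesis
  proof (cases "I = \<infinity>")
    case True
    then show ?thesis by (simp add: Lp_norm_def I_def)
  next
    case False
    have "c powr q * v \<le> enn2real I"
      using I False assms by (simp add: enn2real_leI le_ennreal_iff top.not_eq_extremum ennreal_le_iff2)
        (metis I enn2real_ennreal enn2real_mono infinity_ennreal_def mult_nonneg_nonneg powr_ge_zero top.not_eq_extremum)
    then have "(c powr q * v) powr (1 / q) \<le> enn2real I powr (1 / q)"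
      using assms by (intro powr_mono2) auto
    moreover have "(c powr q * v) powr (1 / q) = c * v powr (1 / q)"
      using assms by (simp add: powr_mult powr_powr)
    ultimately show ?thesis
      using False by (simp add: Lp_norm_def I_def[symmetric] ennreal_leI)
  qed
qed

abbreviation comb_weight :: "real \<Rightarrow> nat \<Rightarrow> real \<Rightarrow> complex" where
  "comb_weight a l \<equiv> (\<lambda>x. complex_of_real (density_pieces.weight (comb_piece a) l x))"

lemma comb_weight_Lp:
  assumes "0 < a" "1 < p"
  shows "0 < Lp_norm p (comb_measure a) (comb_weight a l)"
    and "Lp_norm p (comb_measure a) (comb_weight a l) \<le> ennreal (comb_mass a l powr (1 / p))"
    and "comb_weight a l \<in> Lp_space p (comb_measure a)"
proof -
  interpret density_pieces "comb_piece a" by (rule density_pieces_comb) fact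
  show pos: "0 < Lp_norm p superposition (comb_weight a l)"
    and le: "Lp_norm p superposition (comb_weight a l) \<le> ennreal (comb_mass a l powr (1 / p))"
    using Lp_norm_weight[of p l] assms comb_mass_pos by (auto simp: integral_comb_piece)
  show "comb_weight a l \<in> Lp_space p superposition"
    using le by (auto simp: Lp_space_def intro: le_less_trans)
qed

text \<open>A multiple of \<open>2 ^ level b l\<close> is also a multiple of
  \<open>2 ^ level a l\<close>, since the levels are monotone; one frequency set thus serves all
  exponents up to \<open>b\<close>.\<close>

lemma norm_fourier_comb_weight_ge:
  assumes "0 < a" "a \<le> b" "\<xi> \<in> frequency_set (level b l) l"
  shows "comb_mass a l / 2 \<le> norm (fourier_measure (comb_measure a) (comb_weight a l) \<xi>)"
proof -
  interpret density_pieces "comb_piece a" by (rule density_pieces_comb) fact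
  show ?thesis
    unfolding fourier_superposition_weight
    using assms level_mono[of a b l] by (intro norm_fourier_comb_piece_ge)
qed

lemma power_frequency_ge:
  assumes "0 < b"
  shows "2 powr ((1 - b / 2) * real l - 9) \<le> 2 ^ (l - 5 - level b l) / 16"
proof -
  have "real (level b l) \<le> b * real l / 2"
    using assms of_int_floor_le[of "b * real l / 2"] by (simp add: level_def del: of_int_floor_le)
  \<comment> \<open>The 9 is the 5 from the number of intervals plus the 4 from
    \<open>16 = 2 ^ 4\<close>; truncated subtraction only enlarges the right-hand side.\<close>
  then have "(1 - b / 2) * real l - 9 \<le> real (l - 5 - level b l) - 4"
    by (simp add: algebra_simps)
  then have "2 powr ((1 - b / 2) * real l - 9) \<le> 2 powr (real (l - 5 - level b l) - 4)"
    by simp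
  also have "\<dots> = 2 ^ (l - 5 - level b l) / 16"
    by (simp add: powr_diff powr_realpow)
  finally show ?thesis .
qed

lemma ennreal_inverse_antimono:
  fixes x y :: ennreal
  shows "x \<le> y \<Longrightarrow> inverse y \<le> inverse x"
  by (simp add: less_eq_ennreal.rep_eq inverse_ennreal.rep_eq ereal_inverse_antimono)

text \<open>The first term of \<open>\<kappa>\<close> comes from the measure of the frequency set,
  at least about \<open>2 powr ((1 - b / 2) * real l)\<close>. The second comes from the factors:
  each contributes its mass, about \<open>2 powr - (a m * real l / 2)\<close>, to the power
  \<open>1 - 1 / p\<close>. In \<open>K\<close>, the 9 belongs to the frequency set, and each factor
  costs 1 for the halved lower bound and \<open>1 - 1 / p\<close> for the rounding in
  \<open>level\<close>.\<close>

lemma comb_quotient_ge: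
  fixes a :: "nat \<Rightarrow> real"
  assumes "finite S" "\<And>m. m \<in> S \<Longrightarrow> 0 < a m" "\<And>m. m \<in> S \<Longrightarrow> a m \<le> b" "0 < b" "1 < p" "0 < q"
  defines "\<kappa> \<equiv> (1 - b / 2) / q - (1 - 1 / p) * (\<Sum>m\<in>S. a m) / 2"
    and "K \<equiv> 9 / q + (\<Sum>m\<in>S. 2 - 1 / p)"
  shows "ennreal (2 powr (\<kappa> * real l - K))
    \<le> Lp_norm q lborel (\<lambda>\<xi>. \<Prod>m\<in>S. fourier_measure (comb_measure (a m)) (comb_weight (a m) l) \<xi>)
      / (\<Prod>m\<in>S. Lp_norm p (comb_measure (a m)) (comb_weight (a m) l))"
    (is "_ \<le> ?N / ?D")
proof -
  define v where "v = (2 ^ (l - 5 - level b l) / 16 :: real)"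
  define num where "num = (\<Prod>m\<in>S. comb_mass (a m) l / 2) * v powr (1 / q)"
  define den where "den = (\<Prod>m\<in>S. comb_mass (a m) l powr (1 / p))"
  have N: "ennreal num \<le> ?N"
    unfolding num_def
  proof (rule Lp_norm_ge)
    show "frequency_set (level b l) l \<in> sets lborel" by simp
    show "ennreal v \<le> emeasure lborel (frequency_set (level b l) l)"
      unfolding v_def emeasure_frequency_set ..
    show "(\<Prod>m\<in>S. comb_mass (a m) l / 2)
        \<le> norm (\<Prod>m\<in>S. fourier_measure (comb_measure (a m)) (comb_weight (a m) l) \<xi>)"
      if "\<xi> \<in> frequency_set (level b l) l" for \<xi>
      unfolding prod_norm[symmetric] using that assms
      by (intro prod_mono conjI norm_fourier_comb_weight_ge) (auto simp: comb_mass_pos less_imp_le)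
  qed (use assms in \<open>auto simp: v_def comb_mass_pos less_imp_le intro!: prod_nonneg\<close>)
  have "?D \<le> (\<Prod>m\<in>S. ennreal (comb_mass (a m) l powr (1 / p)))"
    using assms(2,5) by (intro prod_mono_ennreal comb_weight_Lp)
  also have "\<dots> = ennreal den" unfolding den_def by (intro prod_ennreal) auto
  finally have D: "?D \<le> ennreal den" .
  have den_pos: "0 < den" unfolding den_def by (intro prod_pos) (simp add: comb_mass_pos less_imp_neq[symmetric])
  have num_nonneg: "0 \<le> num"
    unfolding num_def by (intro mult_nonneg_nonneg prod_nonneg) (auto simp: comb_mass_pos less_imp_le)
  have v: "2 powr (((1 - b / 2) * real l - 9) / q) \<le> v powr (1 / q)"
    using powr_mono2[OF _ _ power_frequency_ge[of b l], of "1 / q"] assms by (simp add: v_def powr_powr)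
  have factor: "2 powr (- (1 - 1 / p) * a m * real l / 2 - (2 - 1 / p))
      \<le> comb_mass (a m) l / 2 / comb_mass (a m) l powr (1 / p)" for m
  proof -
    have "2 powr (- (1 - 1 / p) * a m * real l / 2 - (2 - 1 / p))
        = (2 powr (- (a m * real l / 2) - 1)) powr (1 - 1 / p) / 2"
    proof -
      have "- (1 - 1 / p) * a m * real l / 2 - (2 - 1 / p) = (- (a m * real l / 2) - 1) * (1 - 1 / p) - 1"
        by (simp add: field_simps)
      then show ?thesis unfolding powr_powr by (simp only: powr_diff[of 2 _ 1] powr_one)
    qed
    also have "\<dots> \<le> comb_mass (a m) l powr (1 - 1 / p) / 2"
      using comb_mass_ge[of "a m" l] assms by (intro divide_right_mono powr_mono2) auto
    also have "\<dots> = comb_mass (a m) l / 2 / comb_mass (a m) l powr (1 / p)"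
      using comb_mass_pos[of "a m" l] by (simp add: powr_diff)
    finally show ?thesis .
  qed
  have "\<kappa> * real l - K = (\<Sum>m\<in>S. - (1 - 1 / p) * a m * real l / 2 - (2 - 1 / p)) + ((1 - b / 2) * real l - 9) / q"
  proof -
    have "(\<Sum>m\<in>S. - (1 - 1 / p) * a m * real l / 2) = - (1 - 1 / p) * (\<Sum>m\<in>S. a m) * real l / 2"
      by (simp only: sum_divide_distrib sum_distrib_left sum_distrib_right)
    then show ?thesis
      unfolding \<kappa>_def K_def sum_subtractf[of "\<lambda>m. - (1 - 1 / p) * a m * real l / 2"]
      by (simp add: diff_divide_distrib add_divide_distrib algebra_simps)
  qed
  then have "2 powr (\<kappa> * real l - K)
      = (\<Prod>m\<in>S. 2 powr (- (1 - 1 / p) * a m * real l / 2 - (2 - 1 / p))) * 2 powr (((1 - b / 2) * real l - 9) / q)"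
    using assms(1) by (simp add: powr_add powr_sum)
  also have "\<dots> \<le> (\<Prod>m\<in>S. comb_mass (a m) l / 2 / comb_mass (a m) l powr (1 / p)) * v powr (1 / q)"
    using factor by (intro mult_mono v prod_mono prod_nonneg) (auto simp: comb_mass_pos less_imp_le)
  also have "\<dots> = num / den" by (simp only: num_def den_def prod_dividef times_divide_eq_left)
  finally have "ennreal (2 powr (\<kappa> * real l - K)) \<le> ennreal (num / den)" by (rule ennreal_leI)
  also have "\<dots> = ennreal num / ennreal den"
    using num_nonneg den_pos by (simp add: divide_ennreal)
  also have "\<dots> \<le> ?N / ?D"
    unfolding divide_ennreal_def using N D by (intro mult_mono ennreal_inverse_antimono) auto
  finally show ?thesis .
qed

lemma comb_quotient_tendsto_infinity:
  fixes a :: "nat \<Rightarrow> real"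
  assumes "finite S" "\<And>m. m \<in> S \<Longrightarrow> 0 < a m" "\<And>m. m \<in> S \<Longrightarrow> a m \<le> b" "0 < b" "1 < p" "0 < q"
    and "(1 - 1 / p) * (\<Sum>m\<in>S. a m) / 2 < (1 - b / 2) / q"
  shows "(\<lambda>l. Lp_norm q lborel (\<lambda>\<xi>. \<Prod>m\<in>S. fourier_measure (comb_measure (a m)) (comb_weight (a m) l) \<xi>)
      / (\<Prod>m\<in>S. Lp_norm p (comb_measure (a m)) (comb_weight (a m) l))) \<longlonglongrightarrow> \<infinity>"
proof -
  define \<kappa> where "\<kappa> = (1 - b / 2) / q - (1 - 1 / p) * (\<Sum>m\<in>S. a m) / 2"
  define K where "K = 9 / q + (\<Sum>m\<in>S. 2 - 1 / p)"
  have "0 < \<kappa>" using assms by (simp add: \<kappa>_def)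
  then have "filterlim (\<lambda>l. 2 powr (\<kappa> * real l - K)) at_top sequentially"
    by real_asymp
  then have lim: "(\<lambda>l. ennreal (2 powr (\<kappa> * real l - K))) \<longlonglongrightarrow> \<infinity>"
    by (simp add: ennreal_tendsto_top_eq_at_top) 
  show ?thesis
    by (rule tendsto_sandwich[OF _ _ lim tendsto_const])
      (use comb_quotient_ge[of S a b p q, OF assms(1-6), folded \<kappa>_def K_def] in auto)
qed

section \<open>Choice of the exponents and conclusion\<close>

theorem theorem3p2:
  fixes k :: nat and p q :: real and \<alpha> :: "nat \<Rightarrow> real"
    and t\<^sub>0 :: "nat \<Rightarrow> nat" and N\<^sub>0 :: nat
  assumes "k \<ge> 2"
    and "1 < p" and "1 \<le> q"
    and "0 < \<alpha> k" and "strict_antimono_on {1..k} \<alpha>" and "\<alpha> 1 < 1"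
    and "\<And>m. m \<in> {1..k} \<Longrightarrow> \<alpha> m = ln (real (t\<^sub>0 m)) / ln (real N\<^sub>0)"
    and "(real k - 1) * \<alpha> 1 + \<alpha> k < 2"
  shows "\<exists>(\<mu> :: nat \<Rightarrow> real measure) (E :: nat \<Rightarrow> real set).
    (\<forall>m\<in>{1..k}.
       finite_borel_measure (\<mu> m) \<and> emeasure (\<mu> m) UNIV \<noteq> 0 \<and>
       compact (E m) \<and> supported_on (\<mu> m) (E m) \<and>
       fourier_decay (\<mu> m) (\<alpha> m) \<and> ball_condition (\<mu> m) (E m) (\<alpha> m)) \<and>
    (q < p * (2 - (\<Sum>m=1..k. \<alpha> m)) / ((p - 1) * (\<Sum>m=1..k. \<alpha> m)) \<longrightarrow>
       (\<exists>f :: nat \<Rightarrow> nat \<Rightarrow> real \<Rightarrow> complex.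
          (\<forall>l. \<forall>m\<in>{1..k}. f l m \<in> Lp_space p (\<mu> m) \<and> 0 < Lp_norm p (\<mu> m) (f l m)) \<and>
          (\<lambda>l. Lp_norm q lborel (\<lambda>\<xi>. \<Prod>m=1..k. fourier_measure (\<mu> m) (f l m) \<xi>)
                / (\<Prod>m=1..k. Lp_norm p (\<mu> m) (f l m))) \<longlonglongrightarrow> \<infinity>))"
proof -
  define S where "S = (\<Sum>m=1..k. \<alpha> m)"
  have anti: "\<alpha> n < \<alpha> m" if "1 \<le> m" "m < n" "n \<le> k" for m n
    using assms(5) that by (auto simp: monotone_on_def)
  have pos: "0 < \<alpha> m" if "m \<in> {1..k}" for m
    using anti[of m k] that assms(4) by (cases "m = k") auto
  have le1: "\<alpha> m \<le> \<alpha> 1" if "m \<in> {1..k}" for m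
    using anti[of 1 m] that by (cases "m = 1") auto
  have \<alpha>1: "0 < \<alpha> 1" "\<alpha> 1 < 1" using pos[of 1] assms(1,6) by auto
  have "\<alpha> 1 \<le> S"
    unfolding S_def using pos assms(1) by (intro member_le_sum) (auto intro: less_imp_le)
  \<comment> \<open>For the exponents \<open>c * \<alpha> m\<close>, the largest being
    \<open>b = c * \<alpha> 1\<close>, the divergence criterion reads
    \<open>c * (q * (1 - 1 / p) * S) < 2 - c * \<alpha> 1\<close>, that is
    \<open>c * D < 2\<close>.\<close>
  define D where "D = q * (1 - 1 / p) * S + \<alpha> 1"
  have D: "\<alpha> 1 \<le> D"
    using \<open>\<alpha> 1 \<le> S\<close> \<alpha>1 assms(2,3) by (simp add: D_def)
  \<comment> \<open>Here \<open>1 < c\<close> gives the margin for the ball condition,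
    \<open>c * \<alpha> 1 < 2\<close> keeps the teeth disjoint, and the third condition gives
    divergence. For \<open>D < 2\<close>, \<open>c * D\<close> is placed midway between
    \<open>D\<close> and 2; otherwise \<open>c = 2\<close> works because
    \<open>\<alpha> 1 < 1\<close>.\<close>
  obtain c where c: "1 < c" "c * \<alpha> 1 < 2" "D < 2 \<Longrightarrow> c * D < 2"
  proof (cases "D < 2")
    case True
    define c where "c = (1 + 2 / D) / 2"
    have "c * D = (D + 2) / 2" using D \<alpha>1 by (simp add: c_def field_simps)
    then have "c * D < 2" using True by simp
    moreover have "1 < c" using True D \<alpha>1 by (simp add: c_def)
    moreover have "c * \<alpha> 1 \<le> c * D" using D \<open>1 < c\<close> by (intro mult_left_mono) auto
    ultimately show ?thesis by (intro that[of c]) linarith+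
  next
    case False
    then show ?thesis using \<alpha>1 by (intro that[of 2]) auto
  qed
  have ca: "\<alpha> m < c * \<alpha> m" "c * \<alpha> m \<le> c * \<alpha> 1" "\<alpha> m < 1" if "m \<in> {1..k}" for m
    using c(1) pos[OF that] le1[OF that] \<alpha>1 by auto
  have quotient: "(\<lambda>l. Lp_norm q lborel
        (\<lambda>\<xi>. \<Prod>m=1..k. fourier_measure (comb_measure (c * \<alpha> m)) (comb_weight (c * \<alpha> m) l) \<xi>)
      / (\<Prod>m=1..k. Lp_norm p (comb_measure (c * \<alpha> m)) (comb_weight (c * \<alpha> m) l))) \<longlonglongrightarrow> \<infinity>"
    if q: "q < p * (2 - S) / ((p - 1) * S)"
  proof -
    have "0 < (p - 1) * S" using assms(2) \<alpha>1 \<open>\<alpha> 1 \<le> S\<close> by simp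
    then have "q * ((p - 1) * S) < p * (2 - S)"
      using q by (simp add: pos_less_divide_eq)
    then have "q * (1 - 1 / p) * S < 2 - S"
      using assms(2) by (simp add: field_simps)
    \<comment> \<open>Since \<open>\<alpha> 1 \<le> S\<close>, the preceding inequality yields
      \<open>D < 2\<close>: only the largest exponent enters \<open>D\<close> where the hypothesis
      on \<open>q\<close> has the whole sum.\<close>
    then have "c * D < 2" using c(3) \<open>\<alpha> 1 \<le> S\<close> by (simp add: D_def)
    define X where "X = (1 - 1 / p) * (c * S)"
    have "X * q < 2 - c * \<alpha> 1"
      using \<open>c * D < 2\<close> by (simp add: X_def D_def algebra_simps)
    then have "X / 2 * q < 1 - c * \<alpha> 1 / 2" by simp
    then have "(1 - 1 / p) * (c * S) / 2 < (1 - c * \<alpha> 1 / 2) / q"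
      using assms(3) unfolding X_def by (subst pos_less_divide_eq) auto
    then show ?thesis
      using c(1) \<alpha>1 assms(2,3) pos ca(2)
      by (intro comb_quotient_tendsto_infinity[where b = "c * \<alpha> 1"])
        (auto simp: S_def sum_distrib_left)
  qed
  have measures: "finite_borel_measure (comb_measure (c * \<alpha> m)) \<and>
      emeasure (comb_measure (c * \<alpha> m)) UNIV \<noteq> 0 \<and>
      compact {0..2::real} \<and> supported_on (comb_measure (c * \<alpha> m)) {0..2} \<and>
      fourier_decay (comb_measure (c * \<alpha> m)) (\<alpha> m) \<and>
      ball_condition (comb_measure (c * \<alpha> m)) {0..2} (\<alpha> m)" if "m \<in> {1..k}" for m
  proof -
    have "0 < c * \<alpha> m" using c(1) pos[OF that] by simp
    moreover have "c * \<alpha> m < 2" using c(2) ca(2)[OF that] by linarith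
    ultimately show ?thesis
      using ca[OF that] pos[OF that]
      by (intro conjI comb_measure_nonzero supported_on_comb_measure fourier_decay_comb_measure
          ball_condition_comb_measure compact_Icc
          density_pieces.finite_borel_measure_superposition density_pieces_comb) auto
  qed
  have weights: "comb_weight (c * \<alpha> m) l \<in> Lp_space p (comb_measure (c * \<alpha> m)) \<and>
      0 < Lp_norm p (comb_measure (c * \<alpha> m)) (comb_weight (c * \<alpha> m) l)" if "m \<in> {1..k}" for l m
    using c(1) pos[OF that] assms(2) by (intro conjI comb_weight_Lp) auto
  show ?thesis
    by (rule exI[of _ "\<lambda>m. comb_measure (c * \<alpha> m)"], rule exI[of _ "\<lambda>_. {0..2}"], intro conjI impI)
      (use measures in blast, rule exI[of _ "\<lambda>l m. comb_weight (c * \<alpha> m) l"],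
        use weights quotient[unfolded S_def] in blast)
qed

end
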